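(* Let $G=(V,E)$ be a finite graph with $d$ vertices, with multiple edges and loops allowed. Then $$A_G(V)=\sum_{S\subseteq E}(-1)^{s(S)}\prod_{C\in\mathcal{C}(S)}v_C .$$ Hence, $$a_G(t)=\sum_{S\subseteq E}(-1)^{s(S)}\prod_{C\in\mathcal{C}(S)}\big(1-(1-t)^{|V(C)|}\big).$$
   Context: Graphs are finite and may have multiple edges and loops. An orientation of $G$ assigns a direction to each edge; it is acyclic if it has no directed cycles (so a graph with a loop has no acyclic orientation). $\mathcal{A}(G)$ is the set of acyclic orientations of $G$. For $\mathfrak{o}\in\mathcal{A}(G)$, a vertex $v$ is a sink if every edge incident with $v$ is directed toward $v$ (in particular, isolated vertices are sinks); $\operatorname{Sink}(\mathfrak{o})$ is the set of sinks of $\mathfrak{o}$ and $\operatorname{sink}(\mathfrak{o})=|\operatorname{Sink}(\mathfrak{o})|$. To each vertex $v\in V$ associate a commuting variable, also denoted $v$, and let $\mathbb{Z}[V]$ be the polynomial ring in these variables. The acyclic orientation polynomial of $G$ is $$A_G(V)=\sum_{\mathfrak{o}\in\mathcal{A}(G)}\ \prod_{v\in\operatorname{Sink}(\mathfrak{o})}v\ \in\mathbb{Z}[V],$$ and $a_G(t)=\sum_{\mathfrak{o}\in\mathcal{A}(G)}t^{\operatorname{sink}(\mathfrak{o})}$ is obtained from it by setting $v=t$ for every $v\in V$. A subset $S\subseteq E$ is identified with the spanning subgraph of $G$ with vertex set $V$ and edge set $S$; $|S|$ is its number of edges, $\mathcal{C}(S)$ is its set of connected components, and $s(S)=|S|-d+|\mathcal{C}(S)|$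 is its corank. For a connected component $C$ with vertex set $V(C)$, put $$v_C=1-\prod_{v\in V(C)}(1-v)\in\mathbb{Z}[V].$$ *)

theory Defs
  imports
    "HOL-Library.Poly_Mapping"
    "HOL-Library.Uprod"
    "HOL-Library.FuncSet"
    "HOL-Computational_Algebra.Polynomial"
    "Graph_Theory.Arc_Walk"
begin

(* Parallel edges are distinct elements of the edge set with equal end points;
   a loop at v is an edge e with ends G e = Upair v v. *)
record ('v, 'e) multigraph =
  vertices :: "'v set"
  edges :: "'e set"
  ends :: "'e \<Rightarrow> 'v uprod"

definition finite_multigraph :: "('v, 'e, 'm) multigraph_scheme \<Rightarrow> bool" where
  "finite_multigraph G \<longleftrightarrow>
     finite (vertices G) \<and> finite (edges G) \<and> (\<forall>e\<in>edges G. set_uprod (ends G e) \<subseteq> vertices G)"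

(* An orientation sends each edge to its (tail, head), and is undefined off the edge set, so that
   orientations of a finite graph form a finite set. A loop is given only one direction here, but
   either direction is a directed cycle, so the acyclic orientations are unaffected. *)
definition orientations :: "('v, 'e, 'm) multigraph_scheme \<Rightarrow> ('e \<Rightarrow> 'v \<times> 'v) set" where
  "orientations G = (\<Pi>\<^sub>E e\<in>edges G. {(u, v). ends G e = Upair u v})"

definition oriented :: "('v, 'e, 'm) multigraph_scheme \<Rightarrow> ('e \<Rightarrow> 'v \<times> 'v) \<Rightarrow> ('v, 'e) pre_digraph" where
  "oriented G \<omega> =
     \<lparr>verts = vertices G, arcs = edges G, tail = (\<lambda>e. fst (\<omega> e)), head = (\<lambda>e. snd (\<omega> e))\<rparr>"

definition acyclic_orientations :: "('v, 'e, 'm) multigraph_scheme \<Rightarrow> ('e \<Rightarrow> 'v \<times> 'v) set" where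
  "acyclic_orientations G =
     {\<omega> \<in> orientations G. \<not> (\<exists>p. pre_digraph.cycle (oriented G \<omega>) p)}"

definition Sinks :: "('v, 'e, 'm) multigraph_scheme \<Rightarrow> ('e \<Rightarrow> 'v \<times> 'v) \<Rightarrow> 'v set" where
  "Sinks G \<omega> =
     {v \<in> vertices G. \<forall>e\<in>edges G. v \<in> set_uprod (ends G e) \<longrightarrow> snd (\<omega> e) = v}"

(* Integer polynomials in variables indexed by the vertices: finitely supported maps from
   monomials (finitely supported exponent maps) to coefficients. *)
type_synonym 'v vpoly = "('v \<Rightarrow>\<^sub>0 nat) \<Rightarrow>\<^sub>0 int"

definition Var :: "'v \<Rightarrow> 'v vpoly" where
  "Var v = Poly_Mapping.single (Poly_Mapping.single v 1) 1"

definition acyclic_orientation_poly :: "('v, 'e, 'm) multigraph_scheme \<Rightarrow> 'v vpoly" where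
  "acyclic_orientation_poly G = (\<Sum>\<omega>\<in>acyclic_orientations G. \<Prod>v\<in>Sinks G \<omega>. Var v)"

definition sink_poly :: "('v, 'e, 'm) multigraph_scheme \<Rightarrow> int poly" where
  "sink_poly G = (\<Sum>\<omega>\<in>acyclic_orientations G. [:0, 1:] ^ card (Sinks G \<omega>))"

definition adjacency :: "('v, 'e, 'm) multigraph_scheme \<Rightarrow> 'e set \<Rightarrow> ('v \<times> 'v) set" where
  "adjacency G S = {(u, v). \<exists>e\<in>S. ends G e = Upair u v}"

(* Components of the spanning subgraph with edge set S, represented by their vertex sets. *)
definition components_of :: "('v, 'e, 'm) multigraph_scheme \<Rightarrow> 'e set \<Rightarrow> 'v set set" where
  "components_of G S =
     vertices G // {(u, v) \<in> vertices G \<times> vertices G. (u, v) \<in> (adjacency G S)\<^sup>*}"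

(* The corank is an integer that is never negative, so converting it by nat
   for use as an exponent loses nothing. *)
definition corank :: "('v, 'e, 'm) multigraph_scheme \<Rightarrow> 'e set \<Rightarrow> int" where
  "corank G S = int (card S) - int (card (vertices G)) + int (card (components_of G S))"

definition component_poly :: "'v set \<Rightarrow> 'v vpoly" where
  "component_poly C = 1 - (\<Prod>v\<in>C. (1 - Var v))"

end

theory Submission
  imports Defs
begin

text \<open>
  Put \<open>y = 1 - x\<close> and write \<open>y U\<close> for the product of \<open>y\<close> over \<open>U\<close>. Expanding the products over
  sinks on one side and over components on the other turns both sides of the identity into
  \<open>\<Sum>U. (-1) ^ card U * y U * c (G - U)\<close>, where \<open>U\<close> ranges over the sets of vertices spanning no
  edge and \<open>c\<close> is the number \<open>a\<close> of acyclic orientations, respectively the sum \<open>b\<close> of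
  \<open>(-1) ^ corank S\<close> over all edge sets \<open>S\<close>. For \<open>y = 1\<close> and a nonempty graph both sides vanish,
  because every acyclic orientation has a sink; hence \<open>a\<close> and \<open>b\<close> satisfy the same recursion
  and agree, and so do the two sides for every \<open>y\<close>.
\<close>

section \<open>Induced subgraphs and sums over subsets\<close>

text \<open>The end map is left unrestricted, since only its values on the edge set matter; edge
  sets of induced subgraphs are thus literally subsets of \<open>edges G\<close>.\<close>

definition induced :: "('v, 'e, 'm) multigraph_scheme \<Rightarrow> 'v set \<Rightarrow> ('v, 'e) multigraph" where
  "induced G W =
     \<lparr>vertices = W, edges = {e \<in> edges G. set_uprod (ends G e) \<subseteq> W}, ends = ends G\<rparr>"

lemma induced_simps [simp]:
  "vertices (induced G W) = W"
  "edges (induced G W) = {e \<in> edges G. set_uprod (ends G e) \<subseteq> W}"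
  "ends (induced G W) = ends G"
  by (simp_all add: induced_def)

text \<open>Identifies the term for empty \<open>U\<close> in the recursion with the count for
  \<open>G\<close> itself. The record type is the unextended one because \<open>induced\<close>
  drops further fields.\<close>

lemma induced_vertices:
  fixes G :: "('v, 'e) multigraph"
  assumes "finite_multigraph G"
  shows "induced G (vertices G) = G"
  using assms by (cases G) (auto simp: induced_def finite_multigraph_def)

lemma finite_multigraph_induced:
  assumes "finite_multigraph G" "W \<subseteq> vertices G"
  shows "finite_multigraph (induced G W)"
  using assms by (auto simp: finite_multigraph_def intro: finite_subset)

lemma finite_multigraphD:
  assumes "finite_multigraph G"
  shows "finite (vertices G)" "finite (edges G)"
    "e \<in> edges G \<Longrightarrow> set_uprod (ends G e) \<subseteq> vertices G"
  using assms by (auto simp: finite_multigraph_def)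

text \<open>Expand the product of the factors \<open>- 1 + 1\<close> over \<open>A\<close>. This
  cancellation later removes every \<open>U\<close> that spans an edge.\<close>

lemma sum_neg_one_Pow:
  assumes "finite A"
  shows "(\<Sum>S\<in>Pow A. (- 1 :: 'a :: comm_ring_1) ^ card S) = (if A = {} then 1 else 0)"
  using prod_add[OF assms, of "\<lambda>_. - 1 :: 'a" "\<lambda>_. 1"] assms by (auto simp: power_0_left)

lemma sum_Pow_Un_disjoint:
  fixes f g :: "'a set \<Rightarrow> 'b :: comm_semiring_0"
  assumes "finite A" "finite B" "A \<inter> B = {}"
  shows "(\<Sum>S\<in>Pow (A \<union> B). f (S \<inter> A) * g (S \<inter> B)) = (\<Sum>S\<in>Pow A. f S) * (\<Sum>S\<in>Pow B. g S)"
proof -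
  have "(\<Sum>S\<in>Pow A. f S) * (\<Sum>S\<in>Pow B. g S) = (\<Sum>(S, T)\<in>Pow A \<times> Pow B. f S * g T)"
    by (simp add: sum_product sum.cartesian_product)
  also have "\<dots> = (\<Sum>S\<in>Pow (A \<union> B). f (S \<inter> A) * g (S \<inter> B))"
    by (rule sum.reindex_bij_witness[where i = "\<lambda>S. (S \<inter> A, S \<inter> B)" and j = "\<lambda>(S, T). S \<union> T"])
      (use assms(3) in \<open>auto simp: Int_Un_distrib2 intro!: arg_cong2[where f = "(*)"]
        arg_cong[where f = f] arg_cong[where f = g]\<close>)
  finally show ?thesis ..
qed

section \<open>Acyclic orientations\<close>

lemma orientation_ends:
  assumes "\<omega> \<in> orientations G" "e \<in> edges G"
  shows "ends G e = Upair (fst (\<omega> e)) (snd (\<omega> e))"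
  using assms unfolding orientations_def by (force dest!: PiE_mem)

text \<open>Every closed walk with an arc contains a cycle, and such walks witness the pairs
  \<open>(u, u)\<close> of the transitive closure. The image relation merges parallel arcs of equal
  direction, which does not affect the existence of cycles.\<close>

lemma acyclic_orientations_iff:
  assumes "finite_multigraph G"
  shows "\<omega> \<in> acyclic_orientations G \<longleftrightarrow> \<omega> \<in> orientations G \<and> acyclic (\<omega> ` edges G)"
proof (cases "\<omega> \<in> orientations G")
  case True
  let ?D = "oriented G \<omega>"
  interpret wf_digraph ?D
    using finite_multigraphD(3)[OF assms] orientation_ends[OF True]
    by unfold_locales (fastforce simp: oriented_def)+
  have D: "arcs_ends ?D = \<omega> ` edges G"
    by (auto simp: arcs_ends_def arc_to_ends_def oriented_def)
  have "(\<exists>p. cycle p) \<longleftrightarrow> (\<exists>u p. awalk u p u \<and> p \<noteq> [])"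
    using closed_w_imp_cycle by (auto simp: cycle_def closed_w_def)
  also have "\<dots> \<longleftrightarrow> \<not> acyclic (\<omega> ` edges G)"
    unfolding acyclic_def D[symmetric] using reachable1_awalk by blast
  finally show ?thesis
    using True by (auto simp: acyclic_orientations_def)
qed (simp add: acyclic_orientations_def)

lemma finite_acyclic_orientations:
  assumes "finite_multigraph G"
  shows "finite (acyclic_orientations G)"
proof -
  have "orientations G \<subseteq> (\<Pi>\<^sub>E e\<in>edges G. vertices G \<times> vertices G)"
    using finite_multigraphD(3)[OF assms] unfolding orientations_def by (intro PiE_mono) force
  moreover have "finite \<dots>"
    using assms by (intro finite_PiE) (auto simp: finite_multigraph_def)
  ultimately show ?thesis
    unfolding acyclic_orientations_def by (auto intro: finite_subset)
qed

text \<open>The converse of a finite acyclic relation is well-founded, so some vertex has no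
  outgoing edge; all edges at it point to it.\<close>

lemma Sinks_nonempty:
  assumes "finite_multigraph G" "vertices G \<noteq> {}" "\<omega> \<in> acyclic_orientations G"
  shows "Sinks G \<omega> \<noteq> {}"
proof
  assume no_sink: "Sinks G \<omega> = {}"
  let ?r = "\<omega> ` edges G"
  have \<omega>: "\<omega> \<in> orientations G" "acyclic ?r"
    using assms acyclic_orientations_iff by blast+
  then have "wf (?r\<inverse>)"
    using finite_multigraphD(2)[OF assms(1)] by (intro finite_acyclic_wf_converse) auto
  moreover from assms(2) obtain v0 where "v0 \<in> vertices G"
    by blast
  ultimately obtain v where v: "v \<in> vertices G" "\<And>w. (v, w) \<in> ?r \<Longrightarrow> w \<notin> vertices G"
    by (auto elim!: wfE_min[where Q = "vertices G"])
  from no_sink v(1) obtain e where e: "e \<in> edges G" "v \<in> set_uprod (ends G e)" "snd (\<omega> e) \<noteq> v"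
    by (auto simp: Sinks_def)
  then have "\<omega> e = (v, snd (\<omega> e))" "snd (\<omega> e) \<in> vertices G"
    using orientation_ends[OF \<omega>(1) e(1)] finite_multigraphD(3)[OF assms(1) e(1)]
    by (auto simp: prod_eq_iff)
  then show False
    using v(2) e(1) by (metis image_eqI)
qed

section \<open>Acyclic orientations with prescribed sinks\<close>

text \<open>No pair starts in \<open>U\<close>, so a path entering \<open>U\<close> stops there and
  cannot close up; a cycle would have to lie in \<open>r\<close> alone.\<close>

lemma acyclic_Un_into_dead_ends:
  assumes "acyclic r" "Range s \<subseteq> U" "Domain (r \<union> s) \<inter> U = {}"
  shows "acyclic (r \<union> s)"
  unfolding acyclic_def
proof (intro allI notI)
  fix x
  assume x: "(x, x) \<in> (r \<union> s)\<^sup>+"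
  have "(x, y) \<in> r\<^sup>+ \<or> y \<in> U" if "(x, y) \<in> (r \<union> s)\<^sup>+" for y
    using that by induction (use assms(2,3) in \<open>auto intro: trancl_into_trancl\<close>)
  moreover have "x \<notin> U"
    using x assms(3) by (metis DomainI disjoint_iff tranclD)
  ultimately show False
    using x assms(1) by (auto simp: acyclic_def)
qed

text \<open>Each edge of \<open>G\<close> missing from \<open>H\<close> has exactly one end in
  \<open>U\<close> and is forced to point to it, while \<open>H\<close> may carry any acyclic
  orientation. The forced edges run into dead ends and hence create no cycle.\<close>

lemma bij_betw_orientations_with_sinks:
  assumes G: "finite_multigraph G" and U: "U \<subseteq> vertices G" "edges (induced G U) = {}"
  defines "H \<equiv> induced G (vertices G - U)"
  shows "bij_betw (\<lambda>\<omega>. restrict \<omega> (edges H))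
           {\<omega> \<in> acyclic_orientations G. U \<subseteq> Sinks G \<omega>} (acyclic_orientations H)"
proof -
  have H: "finite_multigraph H"
    unfolding H_def using G by (intro finite_multigraph_induced) auto
  have HG: "edges H \<subseteq> edges G" "ends H = ends G"
    by (auto simp: H_def)
  have meets: "\<exists>u\<in>U. u \<in> set_uprod (ends G e)" if "e \<in> edges G" "e \<notin> edges H" for e
    using that finite_multigraphD(3)[OF G] by (fastforce simp: H_def)
  have inj: "\<omega> = \<omega>'"
    if \<omega>: "\<omega> \<in> acyclic_orientations G" "U \<subseteq> Sinks G \<omega>"
      and \<omega>': "\<omega>' \<in> acyclic_orientations G" "U \<subseteq> Sinks G \<omega>'"
      and eq: "restrict \<omega> (edges H) = restrict \<omega>' (edges H)" for \<omega> \<omega>'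
  proof
    fix e
    have or: "\<omega> \<in> orientations G" "\<omega>' \<in> orientations G"
      using \<omega> \<omega>' by (auto simp: acyclic_orientations_def)
    consider "e \<notin> edges G" | "e \<in> edges H" | "e \<in> edges G" "e \<notin> edges H"
      by blast
    then show "\<omega> e = \<omega>' e"
    proof cases
      case 1
      with or show ?thesis
        by (auto simp: orientations_def PiE_def extensional_def)
    next
      case 2
      with eq show ?thesis
        by (metis restrict_apply')
    next
      case 3
      with meets obtain u where u: "u \<in> U" "u \<in> set_uprod (ends G e)"
        by blast
      then have "snd (\<omega> e) = u" "snd (\<omega>' e) = u"
        using \<omega>(2) \<omega>'(2) 3 by (auto simp: Sinks_def)
      then show ?thesis
        using orientation_ends[OF or(1) 3(1)] orientation_ends[OF or(2) 3(1)]
        by (auto simp: prod_eq_iff)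
    qed
  qed
  have into: "restrict \<omega> (edges H) \<in> acyclic_orientations H"
    if "\<omega> \<in> acyclic_orientations G" for \<omega>
  proof -
    have \<omega>: "\<omega> \<in> orientations G" "acyclic (\<omega> ` edges G)"
      using that acyclic_orientations_iff[OF G] by blast+
    have "restrict \<omega> (edges H) \<in> orientations H"
      using \<omega>(1) HG unfolding orientations_def by (force simp: PiE_iff)
    moreover have "acyclic (restrict \<omega> (edges H) ` edges H)"
      using \<omega>(2) by (rule acyclic_subset) (use HG in auto)
    ultimately show ?thesis
      using acyclic_orientations_iff[OF H] by blast
  qed
  have onto: "\<exists>\<omega>. \<omega> \<in> acyclic_orientations G \<and> U \<subseteq> Sinks G \<omega> \<and> restrict \<omega> (edges H) = \<eta>"
    if "\<eta> \<in> acyclic_orientations H" for \<eta>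
  proof -
    have \<eta>: "\<eta> \<in> orientations H" "acyclic (\<eta> ` edges H)"
      using that acyclic_orientations_iff[OF H] by blast+
    have "\<exists>p. ends G e = Upair (fst p) (snd p) \<and> snd p \<in> U \<and> fst p \<notin> U"
      if e: "e \<in> edges G" "e \<notin> edges H" for e
    proof -
      obtain a b where ab: "ends G e = Upair a b"
        by (cases "ends G e")
      \<comment> \<open>One end lies in \<open>U\<close> by \<open>meets\<close>; both cannot, since
        \<open>U\<close> spans no edge, loops included.\<close>
      have "a \<in> U \<and> b \<notin> U \<or> a \<notin> U \<and> b \<in> U"
        using U(2) meets[OF e] e(1) ab by auto
      then show ?thesis
        using ab by (metis Upair_inject fst_conv snd_conv)
    qed
    then obtain f where f: "\<And>e. e \<in> edges G \<Longrightarrow> e \<notin> edges H \<Longrightarrow>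
        ends G e = Upair (fst (f e)) (snd (f e)) \<and> snd (f e) \<in> U \<and> fst (f e) \<notin> U"
      by metis
    \<comment> \<open>The value \<open>undefined\<close> off the edge set makes the function
      extensional, as \<open>orientations\<close> demands.\<close>
    define \<omega> where "\<omega> e = (if e \<in> edges H then \<eta> e else if e \<in> edges G then f e else undefined)" for e
    have \<eta>H: "ends G e = Upair (fst (\<eta> e)) (snd (\<eta> e))" "fst (\<eta> e) \<notin> U" if "e \<in> edges H" for e
      using orientation_ends[OF \<eta>(1) that] finite_multigraphD(3)[OF H that] HG(2)
      by (auto simp: H_def)
    have "\<omega> \<in> orientations G"
      unfolding orientations_def
      by (rule PiE_I) (use HG \<eta>H f in \<open>auto simp: \<omega>_def case_prod_beta\<close>)
    moreover have "acyclic (\<omega> ` edges G)"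
    proof -
      have "acyclic (\<eta> ` edges H \<union> f ` (edges G - edges H))"
      proof (rule acyclic_Un_into_dead_ends[OF \<eta>(2)])
        show "Range (f ` (edges G - edges H)) \<subseteq> U"
          using f by (auto simp: Range_iff) (metis snd_conv)
        have "fst p \<notin> U" if "p \<in> \<eta> ` edges H \<union> f ` (edges G - edges H)" for p
          using that f \<eta>H(2) by blast
        then show "Domain (\<eta> ` edges H \<union> f ` (edges G - edges H)) \<inter> U = {}"
          by force
      qed
      moreover have "\<omega> ` edges G = \<eta> ` edges H \<union> f ` (edges G - edges H)"
        using HG(1) by (auto simp: \<omega>_def image_iff)
      ultimately show ?thesis
        by simp
    qed
    moreover have "U \<subseteq> Sinks G \<omega>"
    proof
      fix u
      assume u: "u \<in> U"
      have "snd (\<omega> e) = u" if e: "e \<in> edges G" "u \<in> set_uprod (ends G e)" for e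
      proof -
        have "e \<notin> edges H"
          using e u by (auto simp: H_def)
        with f e u show ?thesis
          by (fastforce simp: \<omega>_def)
      qed
      with u U(1) show "u \<in> Sinks G \<omega>"
        by (auto simp: Sinks_def)
    qed
    moreover have "restrict \<omega> (edges H) = \<eta>"
      using \<eta>(1) by (auto simp: \<omega>_def restrict_def orientations_def PiE_def extensional_def)
    ultimately show ?thesis
      using acyclic_orientations_iff[OF G] by blast
  qed
  show ?thesis
    unfolding bij_betw_def inj_on_def using inj into onto by blast
qed

text \<open>An edge spanned by \<open>U\<close> would have both its ends as head, so it would be a
  loop, and a loop is a directed cycle.\<close>

lemma no_orientation_with_adjacent_sinks:
  assumes G: "finite_multigraph G" and "edges (induced G U) \<noteq> {}"
  shows "{\<omega> \<in> acyclic_orientations G. U \<subseteq> Sinks G \<omega>} = {}"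
proof -
  from assms(2) obtain e where e: "e \<in> edges G" "set_uprod (ends G e) \<subseteq> U"
    by auto
  have False if \<omega>: "\<omega> \<in> acyclic_orientations G" "U \<subseteq> Sinks G \<omega>" for \<omega>
  proof -
    have or: "\<omega> \<in> orientations G" "acyclic (\<omega> ` edges G)"
      using \<omega>(1) acyclic_orientations_iff[OF G] by blast+
    have "fst (\<omega> e) \<in> Sinks G \<omega>"
      using orientation_ends[OF or(1) e(1)] e(2) \<omega>(2) by auto
    then have "snd (\<omega> e) = fst (\<omega> e)"
      using orientation_ends[OF or(1) e(1)] e(1) by (auto simp: Sinks_def)
    then have "(fst (\<omega> e), fst (\<omega> e)) \<in> \<omega> ` edges G"
      using e(1) by (metis image_eqI prod.collapse)
    then show False
      using or(2) by (auto simp: acyclic_def)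
  qed
  then show ?thesis
    by blast
qed

text \<open>Expand each product over the subsets \<open>U\<close> of the sinks and exchange the
  sums. The coefficient of \<open>U\<close> then counts the acyclic orientations in which all of
  \<open>U\<close> are sinks, which the two preceding lemmas determine.\<close>

lemma acyclic_orientation_sum_expansion:
  fixes y :: "'v \<Rightarrow> 'a :: comm_ring_1"
  assumes G: "finite_multigraph G"
  shows "(\<Sum>\<omega>\<in>acyclic_orientations G. \<Prod>v\<in>Sinks G \<omega>. 1 - y v) =
    (\<Sum>U\<in>Pow (vertices G). (- 1) ^ card U * (\<Prod>v\<in>U. y v) *
       (if edges (induced G U) = {}
        then of_nat (card (acyclic_orientations (induced G (vertices G - U)))) else 0))"
proof -
  note fin = finite_multigraphD[OF G]
  have Sinks: "Sinks G \<omega> \<subseteq> vertices G" for \<omega>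
    by (auto simp: Sinks_def)
  have "(\<Sum>\<omega>\<in>acyclic_orientations G. \<Prod>v\<in>Sinks G \<omega>. 1 - y v) =
    (\<Sum>\<omega>\<in>acyclic_orientations G. \<Sum>U | U \<in> Pow (vertices G) \<and> U \<subseteq> Sinks G \<omega>.
       (- 1) ^ card U * (\<Prod>v\<in>U. y v))"
  proof (rule sum.cong[OF refl])
    fix \<omega>
    have "Pow (Sinks G \<omega>) = {U. U \<in> Pow (vertices G) \<and> U \<subseteq> Sinks G \<omega>}"
      using Sinks by blast
    then show "(\<Prod>v\<in>Sinks G \<omega>. 1 - y v) =
        (\<Sum>U | U \<in> Pow (vertices G) \<and> U \<subseteq> Sinks G \<omega>. (- 1) ^ card U * (\<Prod>v\<in>U. y v))"
      using prod_diff_conv_sum[OF finite_subset[OF Sinks fin(1)], of "\<lambda>_. 1" y \<omega>] by simp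
  qed
  also have "\<dots> = (\<Sum>U\<in>Pow (vertices G). \<Sum>\<omega> | \<omega> \<in> acyclic_orientations G \<and> U \<subseteq> Sinks G \<omega>.
       (- 1) ^ card U * (\<Prod>v\<in>U. y v))"
    using finite_acyclic_orientations[OF G] fin(1) by (intro sum.swap_restrict) auto
  also have "\<dots> = (\<Sum>U\<in>Pow (vertices G). (- 1) ^ card U * (\<Prod>v\<in>U. y v) *
       (if edges (induced G U) = {}
        then of_nat (card (acyclic_orientations (induced G (vertices G - U)))) else 0))"
  proof (rule sum.cong[OF refl])
    fix U
    assume "U \<in> Pow (vertices G)"
    then have count: "card {\<omega> \<in> acyclic_orientations G. U \<subseteq> Sinks G \<omega>} =
      (if edges (induced G U) = {}
       then card (acyclic_orientations (induced G (vertices G - U))) else 0)"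
      using bij_betw_same_card[OF bij_betw_orientations_with_sinks[OF G, of U]]
        no_orientation_with_adjacent_sinks[OF G, of U]
      by (simp del: induced_simps Collect_empty_eq)
    then show "(\<Sum>\<omega> | \<omega> \<in> acyclic_orientations G \<and> U \<subseteq> Sinks G \<omega>.
        (- 1) ^ card U * (\<Prod>v\<in>U. y v)) = (- 1) ^ card U * (\<Prod>v\<in>U. y v) *
       (if edges (induced G U) = {}
        then of_nat (card (acyclic_orientations (induced G (vertices G - U)))) else 0)"
      unfolding sum_constant count by (simp del: induced_simps add: mult.commute)
  qed
  finally show ?thesis .
qed

section \<open>Components of spanning subgraphs\<close>

lemma sym_adjacency: "sym (adjacency G S)"
  by (auto simp: sym_def adjacency_def) (metis Upair_inject)

text \<open>No edge of \<open>S\<close> crosses the boundary of \<open>W\<close>, so no path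
  does.\<close>

lemma adjacency_rtrancl_closed:
  assumes "(u, v) \<in> (adjacency G S)\<^sup>*" "u \<in> W"
    and closed: "\<And>e. e \<in> S \<Longrightarrow> set_uprod (ends G e) \<subseteq> W \<or> set_uprod (ends G e) \<inter> W = {}"
  shows "v \<in> W"
  using assms(1,2) by induction (use closed in \<open>force simp: adjacency_def\<close>)+

text \<open>A path starting at a vertex of \<open>G\<close> stays among the vertices. Components
  thus become classes of an equivalence on the whole type, free of the restriction to
  \<open>vertices G\<close>.\<close>

lemma components_of_eq:
  assumes "finite_multigraph G" "S \<subseteq> edges G"
  shows "components_of G S = (\<lambda>v. (adjacency G S)\<^sup>* `` {v}) ` vertices G"
proof -
  have "(adjacency G S)\<^sup>* `` {v} \<subseteq> vertices G" if "v \<in> vertices G" for v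
    using that assms finite_multigraphD(3)[OF assms(1)]
    by (auto elim!: adjacency_rtrancl_closed)
  then have "{(u, v) \<in> vertices G \<times> vertices G. (u, v) \<in> (adjacency G S)\<^sup>*} `` {x} =
      (adjacency G S)\<^sup>* `` {x}" if "x \<in> vertices G" for x
    using that by blast
  then show ?thesis
    unfolding components_of_def quotient_def by auto
qed

lemma equiv_adjacency: "equiv UNIV ((adjacency G S)\<^sup>*)"
  by (intro equivI refl_rtrancl sym_rtrancl sym_adjacency trans_rtrancl) auto

lemma component_eq_iff:
  "(adjacency G S)\<^sup>* `` {u} = (adjacency G S)\<^sup>* `` {v} \<longleftrightarrow> (u, v) \<in> (adjacency G S)\<^sup>*"
  using eq_equiv_class_iff[OF equiv_adjacency] by simp

lemma components_of_disjoint: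
  assumes "finite_multigraph G" "S \<subseteq> edges G" "C \<in> components_of G S" "D \<in> components_of G S"
    "C \<noteq> D"
  shows "C \<inter> D = {}"
proof (rule ccontr)
  assume "C \<inter> D \<noteq> {}"
  moreover from assms(3,4) obtain u v
    where "C = (adjacency G S)\<^sup>* `` {u}" "D = (adjacency G S)\<^sup>* `` {v}"
    unfolding components_of_eq[OF assms(1,2)] by blast
  ultimately show False
    using \<open>C \<noteq> D\<close> by (auto simp flip: component_eq_iff)
qed

lemma Union_components_of:
  assumes "finite_multigraph G" "S \<subseteq> edges G"
  shows "\<Union> (components_of G S) = vertices G"
proof
  show "\<Union> (components_of G S) \<subseteq> vertices G"
    unfolding components_of_def quotient_def by auto
  show "vertices G \<subseteq> \<Union> (components_of G S)"
    unfolding components_of_eq[OF assms] by auto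
qed

lemma finite_components_of:
  assumes "finite_multigraph G"
  shows "finite (components_of G S)"
  using finite_multigraphD(1)[OF assms] unfolding components_of_def
  by (intro finite_quotient) auto

lemma components_of_nonempty:
  assumes "finite_multigraph G" "S \<subseteq> edges G"
  shows "{} \<notin> components_of G S"
  unfolding components_of_eq[OF assms] by auto

text \<open>The components containing neither end of the new edge are unaffected.\<close>

lemma card_components_of_insert:
  assumes G: "finite_multigraph G" and S: "insert e S \<subseteq> edges G"
  shows "card (components_of G S) \<le> Suc (card (components_of G (insert e S)))"
proof -
  let ?A = "(adjacency G S)\<^sup>*" and ?B = "(adjacency G (insert e S))\<^sup>*"
  obtain u v where uv: "ends G e = Upair u v"
    by (cases "ends G e")
  with S finite_multigraphD(3)[OF G, of e] have u: "u \<in> vertices G"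
    by auto
  have mono: "?A \<subseteq> ?B"
    by (intro rtrancl_mono) (auto simp: adjacency_def)
  have eq: "?B `` {x} = ?A `` {x}" if x: "(x, u) \<notin> ?A" "(x, v) \<notin> ?A" for x
  proof
    show "?B `` {x} \<subseteq> ?A `` {x}"
    proof
      fix y
      assume "y \<in> ?B `` {x}"
      then have "(x, y) \<in> ?B"
        by simp
      then show "y \<in> ?A `` {x}"
      proof induction
        case (step y z)
        with x uv have "(y, z) \<in> adjacency G S"
          by (auto simp: adjacency_def)
        with step show ?case
          by (auto intro: rtrancl_into_rtrancl)
      qed simp
    qed
  qed (use mono in blast)
  \<comment> \<open>At most the old components of \<open>u\<close> and \<open>v\<close> are lost,
    and the new component of \<open>u\<close> is not among the survivors.\<close>
  have sub: "components_of G S - {?A `` {u}, ?A `` {v}} \<subseteq> components_of G (insert e S) - {?B `` {u}}"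
  proof
    fix C
    assume C: "C \<in> components_of G S - {?A `` {u}, ?A `` {v}}"
    then obtain x where x: "x \<in> vertices G" "C = ?A `` {x}"
      using S by (auto simp: components_of_eq[OF G])
    with C have *: "(x, u) \<notin> ?A" "(x, v) \<notin> ?A"
      by (auto simp: component_eq_iff)
    with eq have "?B `` {x} = ?A `` {x}"
      by blast
    with x * have "C = ?B `` {x}" "(x, u) \<notin> ?B"
      by blast+
    with x S show "C \<in> components_of G (insert e S) - {?B `` {u}}"
      by (auto simp: components_of_eq[OF G] component_eq_iff)
  qed
  have mem: "?B `` {u} \<in> components_of G (insert e S)"
    using u S by (auto simp: components_of_eq[OF G])
  have "card (components_of G S) - 2 \<le> card (components_of G S) - card {?A `` {u}, ?A `` {v}}"
    by (intro diff_le_mono2) (simp add: card_insert_if)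
  also have "\<dots> \<le> card (components_of G S - {?A `` {u}, ?A `` {v}})"
    by (rule diff_card_le_card_Diff) simp
  also have "\<dots> \<le> card (components_of G (insert e S) - {?B `` {u}})"
    using finite_components_of[OF G] sub by (intro card_mono) auto
  also have "\<dots> = card (components_of G (insert e S)) - 1"
    using mem by simp
  finally have "card (components_of G S) - 2 \<le> card (components_of G (insert e S)) - 1" .
  \<comment> \<open>Subtraction is truncated: a new count of 0 would still allow an old count of
    2.\<close>
  moreover have "card (components_of G (insert e S)) > 0"
    using mem finite_components_of[OF G] by (auto simp: card_gt_0_iff)
  ultimately show ?thesis
    by linarith
qed

section \<open>Nonnegativity and parity of the corank\<close>

text \<open>Without edges every vertex is its own component, and each added edge lowers the number
  of components by at most one.\<close>

lemma corank_nonneg: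
  assumes G: "finite_multigraph G" and S: "S \<subseteq> edges G"
  shows "corank G S \<ge> 0"
proof -
  have "finite S"
    using S finite_multigraphD(2)[OF G] finite_subset by blast
  then have "card (vertices G) \<le> card S + card (components_of G S)"
    using S
  proof induction
    case empty
    have "adjacency G {} = {}"
      by (simp add: adjacency_def)
    then have "components_of G {} = (\<lambda>v. {v}) ` vertices G"
      by (auto simp: components_of_eq[OF G])
    then show ?case
      by (simp add: card_image)
  next
    case (insert e S)
    then show ?case
      using card_components_of_insert[OF G insert.prems] by simp
  qed
  then show ?thesis
    by (simp add: corank_def)
qed

text \<open>Only the parity of the corank matters, so subtracting the number of vertices may be
  replaced by adding it. The new exponent is a sum of natural numbers and splits over disjoint
  parts.\<close>

lemma neg_one_power_corank:
  assumes "finite_multigraph G" "S \<subseteq> edges G"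
  shows "(- 1 :: 'a :: ring_1) ^ nat (corank G S) =
           (- 1) ^ (card S + card (vertices G) + card (components_of G S))"
proof -
  have "nat (corank G S) + 2 * card (vertices G) =
      card S + card (vertices G) + card (components_of G S)"
    using corank_nonneg[OF assms] by (simp add: corank_def)
  from this[symmetric] have "(- 1 :: 'a) ^ (card S + card (vertices G) + card (components_of G S)) =
      (- 1) ^ (nat (corank G S) + 2 * card (vertices G))"
    by (rule arg_cong)
  then show ?thesis
    by (simp only: power_add power_mult power2_minus power_one one_power2 mult_1_right)
qed

section \<open>Splitting edge sets along unions of components\<close>

text \<open>A path of \<open>S\<close> that starts in \<open>W\<close> stays in \<open>W\<close> and
  uses only edges of the induced subgraph, so components meeting \<open>W\<close> are inherited
  whole.\<close>

lemma components_of_induced: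
  assumes G: "finite_multigraph G" and S: "S \<subseteq> edges G" and W: "W \<subseteq> vertices G"
    and closed: "\<And>e. e \<in> S \<Longrightarrow> set_uprod (ends G e) \<subseteq> W \<or> set_uprod (ends G e) \<inter> W = {}"
  shows "components_of (induced G W) (S \<inter> edges (induced G W)) = {C \<in> components_of G S. C \<subseteq> W}"
proof -
  let ?H = "induced G W"
  let ?T = "S \<inter> edges ?H"
  have eq: "(adjacency ?H ?T)\<^sup>* `` {x} = (adjacency G S)\<^sup>* `` {x}" if "x \<in> W" for x
  proof
    show "(adjacency ?H ?T)\<^sup>* `` {x} \<subseteq> (adjacency G S)\<^sup>* `` {x}"
      by (intro Image_mono rtrancl_mono subset_refl) (auto simp: adjacency_def)
    show "(adjacency G S)\<^sup>* `` {x} \<subseteq> (adjacency ?H ?T)\<^sup>* `` {x}"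
    proof
      fix y
      assume "y \<in> (adjacency G S)\<^sup>* `` {x}"
      then have "(x, y) \<in> (adjacency G S)\<^sup>*"
        by simp
      then show "y \<in> (adjacency ?H ?T)\<^sup>* `` {x}"
      proof induction
        case (step y z)
        have "y \<in> W"
          using step.hyps(1) \<open>x \<in> W\<close> closed by (rule adjacency_rtrancl_closed)
        with step.hyps(2) closed S have "(y, z) \<in> adjacency ?H ?T"
          by (fastforce simp: adjacency_def)
        with step.IH show ?case
          by (auto intro: rtrancl_into_rtrancl)
      qed simp
    qed
  qed
  have "components_of ?H ?T = (\<lambda>v. (adjacency G S)\<^sup>* `` {v}) ` W"
    using eq by (subst components_of_eq[OF finite_multigraph_induced[OF G W]]) auto
  also have "\<dots> = {C \<in> components_of G S. C \<subseteq> W}"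
    using W closed by (auto simp: components_of_eq[OF G S] elim!: adjacency_rtrancl_closed)
  finally show ?thesis .
qed

text \<open>A vertex set is a union of components exactly when no edge of \<open>S\<close> joins it
  to its complement; disjointness and nonemptiness of components make the choice of components
  unique.\<close>

lemma bij_betw_Union_components:
  assumes G: "finite_multigraph G" and S: "S \<subseteq> edges G"
  shows "bij_betw Union (Pow (components_of G S))
    {U \<in> Pow (vertices G). S \<subseteq> edges (induced G U) \<union> edges (induced G (vertices G - U))}"
proof (rule bij_betw_byWitness[where f' = "\<lambda>U. {C \<in> components_of G S. C \<subseteq> U}"])
  let ?A = "(adjacency G S)\<^sup>*"
  note disj = components_of_disjoint[OF G S] and ne = components_of_nonempty[OF G S]
    and Un = Union_components_of[OF G S]
  have comp: "C = ?A `` {x}" if "C \<in> components_of G S" "x \<in> C" for C x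
    using that by (auto simp: components_of_eq[OF G S] component_eq_iff[symmetric])
  show "\<forall>K\<in>Pow (components_of G S). {C \<in> components_of G S. C \<subseteq> \<Union> K} = K"
  proof
    fix K
    assume K: "K \<in> Pow (components_of G S)"
    have "C \<in> K" if C: "C \<in> components_of G S" "C \<subseteq> \<Union> K" for C
    proof -
      from C ne obtain x where "x \<in> C"
        by (metis all_not_in_conv)
      with C obtain D where "D \<in> K" "x \<in> D"
        by blast
      with K disj C \<open>x \<in> C\<close> show ?thesis
        by blast
    qed
    with K show "{C \<in> components_of G S. C \<subseteq> \<Union> K} = K"
      by blast
  qed
  show "\<forall>U\<in>{U \<in> Pow (vertices G). S \<subseteq> edges (induced G U) \<union> edges (induced G (vertices G - U))}.
      \<Union> {C \<in> components_of G S. C \<subseteq> U} = U"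
  proof
    fix U
    assume U: "U \<in> {U \<in> Pow (vertices G).
      S \<subseteq> edges (induced G U) \<union> edges (induced G (vertices G - U))}"
    have "?A `` {x} \<subseteq> U" if "x \<in> U" for x
      using U that by (fastforce elim!: adjacency_rtrancl_closed)
    with U show "\<Union> {C \<in> components_of G S. C \<subseteq> U} = U"
      by (fastforce simp: components_of_eq[OF G S])
  qed
  show "Union ` Pow (components_of G S) \<subseteq>
    {U \<in> Pow (vertices G). S \<subseteq> edges (induced G U) \<union> edges (induced G (vertices G - U))}"
  proof safe
    fix K x C
    assume "K \<subseteq> components_of G S" "C \<in> K" "x \<in> C"
    with Un show "x \<in> vertices G"
      by blast
  next
    fix K e
    assume K: "K \<subseteq> components_of G S" and e: "e \<in> S"
      and not: "e \<notin> edges (induced G (vertices G - \<Union> K))"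
    obtain u v where uv: "ends G e = Upair u v"
      by (cases "ends G e")
    with e have "(u, v) \<in> adjacency G S" "(v, u) \<in> adjacency G S"
      by (auto simp: adjacency_def intro!: bexI[of _ e])
    then have "(u, v) \<in> ?A" "(v, u) \<in> ?A"
      by blast+
    \<comment> \<open>One end in the union suffices: both ends of an edge lie in the same
      component.\<close>
    moreover have "u \<in> \<Union> K \<or> v \<in> \<Union> K"
      using not e S uv finite_multigraphD(3)[OF G, of e] by auto
    ultimately have "u \<in> \<Union> K \<and> v \<in> \<Union> K"
      using comp K by blast
    then show "e \<in> edges (induced G (\<Union> K))"
      using uv e S by auto
  qed
  show "(\<lambda>U. {C \<in> components_of G S. C \<subseteq> U}) `
      {U \<in> Pow (vertices G). S \<subseteq> edges (induced G U) \<union> edges (induced G (vertices G - U))}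
      \<subseteq> Pow (components_of G S)"
    by blast
qed

text \<open>The value of the Tutte polynomial at (2, 0), in its expansion over spanning
  subgraphs.\<close>

definition signed_subgraph_count :: "('v, 'e, 'm) multigraph_scheme \<Rightarrow> int" where
  "signed_subgraph_count G = (\<Sum>S\<in>Pow (edges G). (- 1) ^ nat (corank G S))"

text \<open>Expand the product over sets \<open>K\<close> of components and let \<open>U\<close> be
  the union of \<open>K\<close>. The components outside \<open>K\<close> are those of the part of
  \<open>S\<close> in \<open>H U\<close>, so edges, vertices and components all split between
  \<open>U\<close> and its complement, and the sign splits with them.\<close>

lemma signed_component_prod_expansion:
  fixes y :: "'v \<Rightarrow> 'a :: comm_ring_1"
  assumes G: "finite_multigraph G" and S: "S \<subseteq> edges G"
  defines "H \<equiv> \<lambda>U. induced G (vertices G - U)"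
  shows "(- 1) ^ nat (corank G S) * (\<Prod>C\<in>components_of G S. 1 - (\<Prod>v\<in>C. y v)) =
    (\<Sum>U | U \<in> Pow (vertices G) \<and> S \<subseteq> edges (induced G U) \<union> edges (H U).
       (- 1) ^ card U * (\<Prod>v\<in>U. y v) *
       ((- 1) ^ card (S \<inter> edges (induced G U)) *
        (- 1) ^ nat (corank (H U) (S \<inter> edges (H U)))))"
proof -
  note fin = finite_multigraphD[OF G]
  have finS: "finite S"
    using S fin(2) finite_subset by blast
  let ?\<K> = "Pow (components_of G S)"
  let ?s = "(- 1 :: 'a) ^ nat (corank G S)"
  let ?f = "\<lambda>U. (- 1) ^ card U * (\<Prod>v\<in>U. y v) *
       ((- 1) ^ card (S \<inter> edges (induced G U)) *
        (- 1) ^ nat (corank (H U) (S \<inter> edges (H U))))"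
  have "?s * (\<Prod>C\<in>components_of G S. 1 - (\<Prod>v\<in>C. y v)) =
      (\<Sum>K\<in>?\<K>. ?s * ((- 1) ^ card K * (\<Prod>C\<in>K. \<Prod>v\<in>C. y v)))"
    using prod_diff_conv_sum[OF finite_components_of[OF G, of S], of "\<lambda>_. 1" "\<lambda>C. \<Prod>v\<in>C. y v"]
    by (simp add: sum_distrib_left)
  also have "\<dots> = (\<Sum>K\<in>?\<K>. ?f (\<Union> K))"
  proof (rule sum.cong[OF refl])
    fix K
    assume K: "K \<in> ?\<K>"
    define U where "U = \<Union> K"
    let ?S1 = "S \<inter> edges (induced G U)" and ?S2 = "S \<inter> edges (H U)"
    have bij: "U \<subseteq> vertices G" "S \<subseteq> edges (induced G U) \<union> edges (H U)"
      using bij_betwE[OF bij_betw_Union_components[OF G S]] K unfolding U_def H_def by blast+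
    have finK: "finite K"
      using K finite_components_of[OF G] finite_subset by blast
    have "components_of (H U) ?S2 = {C \<in> components_of G S. C \<subseteq> vertices G - U}"
      unfolding H_def
    proof (rule components_of_induced[OF G S])
      show "set_uprod (ends G e) \<subseteq> vertices G - U \<or> set_uprod (ends G e) \<inter> (vertices G - U) = {}"
        if "e \<in> S" for e
        using that bij(2) by (auto simp: H_def)
    qed auto
    also have "\<dots> = components_of G S - K"
    proof -
      have "C \<subseteq> vertices G - U \<longleftrightarrow> C \<notin> K" if C: "C \<in> components_of G S" for C
      proof
        have "C \<noteq> {}"
          using C components_of_nonempty[OF G S] by metis
        then show "C \<notin> K" if "C \<subseteq> vertices G - U"
          using that by (auto simp: U_def)
        show "C \<subseteq> vertices G - U" if "C \<notin> K"
        proof -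
          have "C \<inter> D = {}" if "D \<in> K" for D
            using components_of_disjoint[OF G S C, of D] K that \<open>C \<notin> K\<close> by blast
          then show ?thesis
            using C Union_components_of[OF G S] unfolding U_def by blast
        qed
      qed
      then show ?thesis
        by blast
    qed
    finally have "card (components_of G S) = card K + card (components_of (H U) ?S2)"
      using K finK finite_components_of[OF G, of S]
      by (simp add: card_Diff_subset card_mono)
    moreover have "card S = card ?S1 + card ?S2"
    proof -
      \<comment> \<open>Every edge has an end, so none lies both within \<open>U\<close> and within
        its complement.\<close>
      have "set_uprod (ends G e) \<noteq> {}" for e
        by (cases "ends G e") auto
      then have "?S1 \<inter> ?S2 = {}"
        by (fastforce simp: H_def)
      moreover have "S = ?S1 \<union> ?S2"
        using bij(2) by blast
      ultimately show ?thesis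
        using finS by (metis card_Un_disjoint finite_Int)
    qed
    moreover have "card (vertices G) = card U + card (vertices (H U))"
      using bij(1) fin(1) by (simp add: H_def card_Diff_subset finite_subset card_mono)
    moreover have "(- 1 :: 'a) ^ nat (corank (H U) ?S2) =
        (- 1) ^ (card ?S2 + card (vertices (H U)) + card (components_of (H U) ?S2))"
      using finite_multigraph_induced[OF G] unfolding H_def by (intro neg_one_power_corank) auto
    \<comment> \<open>\<open>card K\<close> enters twice, from the expansion and as the number of
      components inside \<open>U\<close>, and cancels modulo 2. Only the vertices and edges inside
      \<open>U\<close> and the corank outside remain.\<close>
    ultimately have sign: "?s * (- 1) ^ card K =
        (- 1) ^ card U * ((- 1) ^ card ?S1 * (- 1) ^ nat (corank (H U) ?S2))"
      unfolding neg_one_power_corank[OF G S]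
      by (simp add: power_add algebra_simps flip: power_mult_distrib)
    have "(\<Prod>C\<in>K. \<Prod>v\<in>C. y v) = (\<Prod>v\<in>U. y v)"
      unfolding U_def
    proof (subst prod.Union_disjoint)
      show "\<forall>C\<in>K. finite C"
        using K fin(1) Union_components_of[OF G S] by (metis PowD Sup_upper finite_subset subsetD)
      show "\<forall>C\<in>K. \<forall>D\<in>K. C \<noteq> D \<longrightarrow> C \<inter> D = {}"
        using K components_of_disjoint[OF G S] by blast
    qed simp
    then have "?s * ((- 1) ^ card K * (\<Prod>C\<in>K. \<Prod>v\<in>C. y v)) =
        (?s * (- 1) ^ card K) * (\<Prod>v\<in>U. y v)"
      by (simp only: mult.assoc)
    also have "\<dots> = ?f U"
      unfolding sign by (simp only: ac_simps)
    finally show "?s * ((- 1) ^ card K * (\<Prod>C\<in>K. \<Prod>v\<in>C. y v)) = ?f (\<Union> K)"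
      by (simp only: U_def)
  qed
  also have "\<dots> = (\<Sum>U | U \<in> Pow (vertices G) \<and> S \<subseteq> edges (induced G U) \<union> edges (H U). ?f U)"
    using bij_betw_Union_components[OF G S] unfolding H_def
    by (rule sum.reindex_bij_betw[where g = ?f, unfolded H_def])
  finally show ?thesis .
qed

text \<open>For fixed \<open>U\<close> the edges of \<open>S\<close> inside and outside
  \<open>U\<close> are chosen independently. The inside choice contributes the alternating sum over
  all sets of edges spanned by \<open>U\<close>, which vanishes unless there are none.\<close>

lemma component_sum_expansion:
  fixes y :: "'v \<Rightarrow> 'a :: comm_ring_1"
  assumes G: "finite_multigraph G"
  shows "(\<Sum>S\<in>Pow (edges G). (- 1) ^ nat (corank G S) *
       (\<Prod>C\<in>components_of G S. 1 - (\<Prod>v\<in>C. y v))) =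
    (\<Sum>U\<in>Pow (vertices G). (- 1) ^ card U * (\<Prod>v\<in>U. y v) *
       (if edges (induced G U) = {}
        then of_int (signed_subgraph_count (induced G (vertices G - U))) else 0))"
proof -
  note fin = finite_multigraphD[OF G]
  let ?E = "\<lambda>U. edges (induced G U)" and ?H = "\<lambda>U. induced G (vertices G - U)"
  let ?w = "\<lambda>U. (- 1) ^ card U * (\<Prod>v\<in>U. y v)"
  let ?g = "\<lambda>U T. (- 1 :: 'a) ^ nat (corank (?H U) T)"
  have "(\<Sum>S\<in>Pow (edges G). (- 1) ^ nat (corank G S) *
       (\<Prod>C\<in>components_of G S. 1 - (\<Prod>v\<in>C. y v))) =
    (\<Sum>S\<in>Pow (edges G). \<Sum>U | U \<in> Pow (vertices G) \<and> S \<subseteq> ?E U \<union> edges (?H U).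
       ?w U * ((- 1) ^ card (S \<inter> ?E U) * ?g U (S \<inter> edges (?H U))))"
    using signed_component_prod_expansion[OF G] by (intro sum.cong) auto
  also have "\<dots> = (\<Sum>U\<in>Pow (vertices G). \<Sum>S | S \<in> Pow (edges G) \<and> S \<subseteq> ?E U \<union> edges (?H U).
       ?w U * ((- 1) ^ card (S \<inter> ?E U) * ?g U (S \<inter> edges (?H U))))"
    using fin by (intro sum.swap_restrict) auto
  also have "\<dots> = (\<Sum>U\<in>Pow (vertices G). ?w U *
       (if ?E U = {} then of_int (signed_subgraph_count (?H U)) else 0))"
  proof (rule sum.cong[OF refl])
    fix U
    have "set_uprod (ends G e) \<noteq> {}" for e
      by (cases "ends G e") auto
    then have disj: "?E U \<inter> edges (?H U) = {}"
      by fastforce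
    have finE: "finite (?E U)" "finite (edges (?H U))"
      using fin(2) by auto
    have "{S. S \<in> Pow (edges G) \<and> S \<subseteq> ?E U \<union> edges (?H U)} = Pow (?E U \<union> edges (?H U))"
      by auto
    then have "(\<Sum>S | S \<in> Pow (edges G) \<and> S \<subseteq> ?E U \<union> edges (?H U).
        ?w U * ((- 1) ^ card (S \<inter> ?E U) * ?g U (S \<inter> edges (?H U)))) =
      ?w U * ((\<Sum>S\<in>Pow (?E U). (- 1) ^ card S) * (\<Sum>S\<in>Pow (edges (?H U)). ?g U S))"
      using sum_Pow_Un_disjoint[OF finE disj, of "\<lambda>S. (- 1) ^ card S" "?g U"]
      by (simp only: sum_distrib_left[symmetric])
    also have "\<dots> = ?w U * (if ?E U = {} then of_int (signed_subgraph_count (?H U)) else 0)"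
      by (simp add: sum_neg_one_Pow[OF finE(1)] signed_subgraph_count_def del: induced_simps)
    finally show "(\<Sum>S | S \<in> Pow (edges G) \<and> S \<subseteq> ?E U \<union> edges (?H U).
        ?w U * ((- 1) ^ card (S \<inter> ?E U) * ?g U (S \<inter> edges (?H U)))) =
      ?w U * (if ?E U = {} then of_int (signed_subgraph_count (?H U)) else 0)" .
  qed
  finally show ?thesis .
qed

section \<open>Comparison of the two expansions\<close>

text \<open>Induction on the number of vertices: at \<open>y = 1\<close> both expansions vanish, and
  every nonempty \<open>U\<close> leaves a smaller graph, so the terms for empty \<open>U\<close>
  must agree.\<close>

lemma card_acyclic_orientations:
  fixes G :: "('v, 'e) multigraph"
  assumes "finite_multigraph G"
  shows "int (card (acyclic_orientations G)) = signed_subgraph_count G"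
  using assms
proof (induction "card (vertices G)" arbitrary: G rule: less_induct)
  case less
  note G = less.prems
  note fin = finite_multigraphD[OF G]
  show ?case
  proof (cases "vertices G = {}")
    case True
    have "edges G = {}"
    proof (rule equals0I)
      fix e
      assume "e \<in> edges G"
      with fin(3) True show False
        by (cases "ends G e") force
    qed
    \<comment> \<open>The empty function is the only orientation and the empty set the only edge
      set, of corank 0: both counts are 1.\<close>
    moreover from this have "acyclic_orientations G = {\<lambda>_. undefined}"
      by (auto simp: acyclic_orientations_iff[OF G] orientations_def acyclic_def)
    ultimately show ?thesis
      using True by (simp add: signed_subgraph_count_def corank_def components_of_def)
  next
    case False
    let ?c = "\<lambda>c U. (- 1) ^ card U * (if edges (induced G U) = {} then c (induced G (vertices G - U)) else 0)"
    let ?a = "\<lambda>H. int (card (acyclic_orientations H))"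
    have "(\<Sum>U\<in>Pow (vertices G). ?c ?a U) = 0"
    proof -
      \<comment> \<open>Every factor is 0, and no product is empty because each acyclic orientation
        has a sink.\<close>
      have "(\<Sum>\<omega>\<in>acyclic_orientations G. \<Prod>v\<in>Sinks G \<omega>. 1 - (1 :: int)) = 0"
      proof (rule sum.neutral, rule ballI)
        fix \<omega>
        assume "\<omega> \<in> acyclic_orientations G"
        moreover have "finite (Sinks G \<omega>)"
          using fin(1) by (simp add: Sinks_def)
        ultimately show "(\<Prod>v\<in>Sinks G \<omega>. 1 - (1 :: int)) = 0"
          using Sinks_nonempty[OF G False, of \<omega>] by (simp add: card_gt_0_iff)
      qed
      then show ?thesis
        using acyclic_orientation_sum_expansion[OF G, of "\<lambda>_. 1 :: int"]
        by (simp del: induced_simps)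
    qed
    moreover have "(\<Sum>U\<in>Pow (vertices G). ?c signed_subgraph_count U) = 0"
    proof -
      \<comment> \<open>Again all factors are 0; the products are nonempty because a graph with a
        vertex has a component.\<close>
      have "(\<Sum>S\<in>Pow (edges G). (- 1) ^ nat (corank G S) *
          (\<Prod>C\<in>components_of G S. 1 - (\<Prod>v\<in>C. (1 :: int)))) = 0"
      proof (rule sum.neutral, rule ballI)
        fix S
        assume "S \<in> Pow (edges G)"
        then have "components_of G S \<noteq> {}"
          using False components_of_eq[OF G] by auto
        then show "(- 1) ^ nat (corank G S) *
          (\<Prod>C\<in>components_of G S. 1 - (\<Prod>v\<in>C. (1 :: int))) = 0"
          using finite_components_of[OF G, of S] by (simp add: card_gt_0_iff)
      qed
      then show ?thesis
        using component_sum_expansion[OF G, of "\<lambda>_. 1 :: int"]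
        by (simp cong: if_cong del: induced_simps)
    qed
    moreover have "(\<Sum>U\<in>Pow (vertices G) - {{}}. ?c ?a U) =
        (\<Sum>U\<in>Pow (vertices G) - {{}}. ?c signed_subgraph_count U)"
    proof (rule sum.cong[OF refl])
      fix U
      assume "U \<in> Pow (vertices G) - {{}}"
      then have "card (vertices (induced G (vertices G - U))) < card (vertices G)"
        using fin(1) by (auto intro!: psubset_card_mono)
      then show "?c ?a U = ?c signed_subgraph_count U"
        using less.hyps finite_multigraph_induced[OF G, of "vertices G - U"] by auto
    qed
    moreover have remove: "(\<Sum>U\<in>Pow (vertices G). f U) = f {} + (\<Sum>U\<in>Pow (vertices G) - {{}}. f U)"
      for f :: "'v set \<Rightarrow> int"
      using fin(1) by (intro sum.remove) auto
    \<comment> \<open>Equal totals and equal contributions of the nonempty \<open>U\<close> leave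
      equal terms at the empty set, where no vertex is removed.\<close>
    ultimately have "?c ?a {} = ?c signed_subgraph_count {}"
      unfolding remove by linarith
    moreover have "edges (induced G {}) = {}"
    proof (rule equals0I)
      fix e
      assume "e \<in> edges (induced G {})"
      then show False
        by (cases "ends G e") auto
    qed
    ultimately show ?thesis
      by (simp add: induced_vertices[OF G] del: induced_simps)
  qed
qed

text \<open>With \<open>y = 1 - x\<close> the two expansions agree term by term. Values in an
  arbitrary commutative ring allow both polynomial identities to be read off as instances.\<close>

theorem weighted_acyclic_orientation_sum:
  fixes G :: "('v, 'e) multigraph" and x :: "'v \<Rightarrow> 'a :: comm_ring_1"
  assumes G: "finite_multigraph G"
  shows "(\<Sum>\<omega>\<in>acyclic_orientations G. \<Prod>v\<in>Sinks G \<omega>. x v) =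
    (\<Sum>S\<in>Pow (edges G). (- 1) ^ nat (corank G S) *
       (\<Prod>C\<in>components_of G S. 1 - (\<Prod>v\<in>C. 1 - x v)))"
proof -
  have "(of_nat (card (acyclic_orientations (induced G (vertices G - U)))) :: 'a) =
      of_int (signed_subgraph_count (induced G (vertices G - U)))" for U
    using card_acyclic_orientations[OF finite_multigraph_induced[OF G, of "vertices G - U"]]
    by (metis Diff_subset of_int_of_nat_eq)
  then show ?thesis
    using acyclic_orientation_sum_expansion[OF G, of "\<lambda>v. 1 - x v"]
      component_sum_expansion[OF G, of "\<lambda>v. 1 - x v"]
    by (simp only: diff_diff_eq2 add_diff_cancel_left')
qed

theorem theorem3p2:
  fixes G :: "('v, 'e) multigraph"
  assumes "finite_multigraph G"
  shows "acyclic_orientation_poly G =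
           (\<Sum>S\<in>Pow (edges G). (-1) ^ nat (corank G S) * (\<Prod>C\<in>components_of G S. component_poly C)) \<and>
         sink_poly G =
           (\<Sum>S\<in>Pow (edges G). (-1) ^ nat (corank G S) *
              (\<Prod>C\<in>components_of G S. (1 - (1 - [:0, 1:]) ^ card C)))"
  \<comment> \<open>The second instance gives all vertices the weight \<open>[:0, 1:]\<close>, that
    is t, so that \<open>prod_constant\<close> turns products over vertices into powers.\<close>
  using weighted_acyclic_orientation_sum[OF assms, of Var]
    weighted_acyclic_orientation_sum[OF assms, of "\<lambda>_. [:0, 1:] :: int poly"]
  unfolding acyclic_orientation_poly_def sink_poly_def component_poly_def prod_constant
  by (rule conjI)

end
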